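(* For $n\in\mathbb{N}$ let $\mathbf{P}^{\mathrm{SRWB}}_n$ be the uniform measure on simple random walk bridges $(x_0,\dots,x_{2n})$ ($x_0=0$, steps $\pm 1$, $x_{2n}=0$) and $\mathbf{P}^{\mathrm{Dyck}}_n$ the uniform measure on Dyck paths of length $2n$ (simple random walk bridges with additionally $x_1,\dots,x_{2n-1}\ge 0$). In either case let $\mathfrak{Z}_n=\{0\}\cup\{t\in\{1,\dots,n\}: x_{2t}=0\}$. Then for every $x\in[0,1]$, $$\lim_{n\to\infty}n^{-1}\ln\mathbf{P}^{\mathrm{SRWB}}_n(|\mathfrak{Z}_n|\ge nx) = -I^{\mathrm{SRWB}}(x),\qquad \lim_{n\to\infty}n^{-1}\ln\mathbf{P}^{\mathrm{Dyck}}_n(|\mathfrak{Z}_n|\ge nx) = -I^{\mathrm{Dyck}}(x),$$ where $$I^{\mathrm{SRWB}}(x)=(2-x)\ln 2+(1-x)\ln(1-x)-(2-x)\ln(2-x),\qquad I^{\mathrm{Dyck}}(x)=2\ln 2+(1-x)\ln(1-x)-(2-x)\ln(2-x)$$ (with the convention $0\ln 0=0$). *)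

theory Defs
  imports "HOL-Probability.Probability"
begin

text \<open>A path \<open>(x\<^sub>0, \<dots>, x\<^sub>2\<^sub>n)\<close> is a list of length \<open>2 n + 1\<close>, so that \<open>p ! k\<close> is \<open>x\<^sub>k\<close>.\<close>

definition srw_bridges :: "nat \<Rightarrow> int list set" where
  "srw_bridges n = {p. length p = 2 * n + 1 \<and> p ! 0 = 0 \<and>
     (\<forall>k < 2 * n. p ! (k + 1) - p ! k \<in> {1, -1}) \<and> p ! (2 * n) = 0}"

definition dyck_paths :: "nat \<Rightarrow> int list set" where
  "dyck_paths n = {p \<in> srw_bridges n. \<forall>k \<in> {1..2 * n - 1}. p ! k \<ge> 0}"

definition P_SRWB :: "nat \<Rightarrow> int list pmf" where
  "P_SRWB n = pmf_of_set (srw_bridges n)"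

definition P_Dyck :: "nat \<Rightarrow> int list pmf" where
  "P_Dyck n = pmf_of_set (dyck_paths n)"

definition zero_times :: "nat \<Rightarrow> int list \<Rightarrow> nat set" where
  "zero_times n p = {0} \<union> {t \<in> {1..n}. p ! (2 * t) = 0}"

text \<open>The convention \<open>0 ln 0 = 0\<close> needs no case distinction at \<open>x = 1\<close>: the factor \<open>1 - x\<close> vanishes.\<close>

definition I_SRWB :: "real \<Rightarrow> real" where
  "I_SRWB x = (2 - x) * ln 2 + (1 - x) * ln (1 - x) - (2 - x) * ln (2 - x)"

definition I_Dyck :: "real \<Rightarrow> real" where
  "I_Dyck x = 2 * ln 2 + (1 - x) * ln (1 - x) - (2 - x) * ln (2 - x)"

text \<open>\<^const>\<open>pmf_of_set\<close> is the uniform distribution only on finite nonempty sets.\<close>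

lemma finite_srw_bridges: "finite (srw_bridges n)"
proof (rule finite_subset)
  show "srw_bridges n \<subseteq> {p. set p \<subseteq> {- int (2 * n)..int (2 * n)} \<and> length p = 2 * n + 1}"
  proof
    fix p assume "p \<in> srw_bridges n"
    then have len: "length p = 2 * n + 1" and zero: "p ! 0 = 0"
      and step: "\<And>k. k < 2 * n \<Longrightarrow> p ! (k + 1) - p ! k \<in> {1, -1}"
      unfolding srw_bridges_def by blast+
    have bound: "\<bar>p ! k\<bar> \<le> int k" if "k \<le> 2 * n" for k
      using that
    proof (induction k)
      case 0
      then show ?case using zero by simp
    next
      case (Suc k)
      then show ?case using step[of k] by auto
    qed
    have "- int (2 * n) \<le> p ! k \<and> p ! k \<le> int (2 * n)" if "k < length p" for k
      using bound[of k] that len by linarith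
    then have "set p \<subseteq> {- int (2 * n)..int (2 * n)}"
      unfolding in_set_conv_nth subset_iff atLeastAtMost_iff by blast
    then show "p \<in> {p. set p \<subseteq> {- int (2 * n)..int (2 * n)} \<and> length p = 2 * n + 1}"
      using len by blast
  qed
  show "finite {p. set p \<subseteq> {- int (2 * n)..int (2 * n)} \<and> length p = 2 * n + 1}"
    by (intro finite_lists_length_eq) simp
qed

lemma finite_dyck_paths: "finite (dyck_paths n)"
  unfolding dyck_paths_def using finite_srw_bridges by simp

lemma dyck_paths_nonempty: "dyck_paths n \<noteq> {}"
proof -
  define p where "p = map (\<lambda>k. int (k mod 2)) [0..<2 * n + 1]"
  have len: "length p = 2 * n + 1"
    by (simp add: p_def)
  have nth: "p ! k = int (k mod 2)" if "k \<le> 2 * n" for k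
    unfolding p_def using that by (subst nth_map) (simp_all del: upt_Suc)
  have step: "p ! (k + 1) - p ! k \<in> {1, -1}" if "k < 2 * n" for k
    using nth[of k] nth[of "k + 1"] that by (cases "even k") (auto simp: mod2_eq_if)
  have nonneg: "p ! k \<ge> 0" if "k \<in> {1..2 * n - 1}" for k
  proof -
    have "k \<le> 2 * n" using that unfolding atLeastAtMost_iff by linarith
    then show ?thesis using nth[of k] by simp
  qed
  have "p \<in> dyck_paths n"
    unfolding dyck_paths_def srw_bridges_def using len step nonneg nth[of 0] nth[of "2 * n"] by simp
  then show ?thesis by blast
qed

lemma srw_bridges_nonempty: "srw_bridges n \<noteq> {}"
  using dyck_paths_nonempty[of n] unfolding dyck_paths_def by blast

end

theory Submission
  imports Defs "HOL-Real_Asymp.Real_Asymp"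
begin

text \<open>
  First-step recursion for walks ending at \<open>0\<close> gives exact tail counts: among the bridges of length
  \<open>2 n\<close>, those with at least \<open>k\<close> returns to \<open>0\<close> number \<open>2\<^sup>k\<close> times the binomial coefficient of
  \<open>2 n - k\<close> over \<open>n\<close>, and among the Dyck paths they number \<open>(k + 1) / (n + 1)\<close> times the same
  coefficient. The event in question asks for at least \<open>k = \<lceil>n x\<rceil> - 1\<close> returns, since
  time \<open>0\<close> is always counted. As \<open>k / n\<close> tends to \<open>x\<close>, the limits follow from
  \<open>ln n! = n ln n - n + O(ln n)\<close>.
\<close>

section \<open>Walks ending at zero and their first-step recursion\<close>

text \<open>The free starting height lets the recursion on the first step close. \<open>Q\<close>
  restrains every visited height; the constant predicate gives bridges, \<open>i \<ge> 0\<close>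
  gives Dyck paths.\<close>

fun walks :: "(int \<Rightarrow> bool) \<Rightarrow> nat \<Rightarrow> int \<Rightarrow> int list set" where
  "walks Q 0 h = (if h = 0 \<and> Q h then {[h]} else {})"
| "walks Q (Suc m) h = (if Q h then Cons h ` (walks Q m (h + 1) \<union> walks Q m (h - 1)) else {})"

lemma mem_walks_iff:
  "p \<in> walks Q m h \<longleftrightarrow> length p = m + 1 \<and> p ! 0 = h \<and>
     (\<forall>k < m. p ! (k + 1) - p ! k \<in> {1, -1}) \<and> p ! m = 0 \<and> (\<forall>k \<le> m. Q (p ! k))"
proof (induction m arbitrary: p h)
  case 0
  show ?case
    by (cases p) auto
next
  case (Suc m)
  show ?case
  proof (cases p)
    case Nil
    then show ?thesis by auto
  next
    case (Cons a q)
    have "(\<forall>k < Suc m. p ! (k + 1) - p ! k \<in> {1, -1}) \<longleftrightarrow>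
        q ! 0 - a \<in> {1, -1} \<and> (\<forall>k < m. q ! (k + 1) - q ! k \<in> {1, -1})"
      by (subst All_less_Suc2) (simp add: Cons)
    moreover have "(\<forall>k \<le> Suc m. Q (p ! k)) \<longleftrightarrow> Q a \<and> (\<forall>k \<le> m. Q (q ! k))"
      using All_less_Suc2[of "Suc m" "\<lambda>k. Q (p ! k)"] by (simp add: Cons less_Suc_eq_le)
    moreover have "p \<in> walks Q (Suc m) h \<longleftrightarrow>
        a = h \<and> Q h \<and> (q \<in> walks Q m (h + 1) \<or> q \<in> walks Q m (h - 1))"
      by (auto simp: Cons)
    ultimately show ?thesis
      unfolding Suc.IH by (auto simp: Cons)
  qed
qed

lemma finite_walks: "finite (walks Q m h)"
  by (induction m arbitrary: h) auto

text \<open>Tail counts rather than exact visit counts, since these have closed forms.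
  \<open>tl\<close> discards the starting point, so for a walk from 0 only genuine returns are
  counted.\<close>

definition num_walks :: "(int \<Rightarrow> bool) \<Rightarrow> nat \<Rightarrow> int \<Rightarrow> nat \<Rightarrow> nat" where
  "num_walks Q m h k = card {p \<in> walks Q m h. k \<le> count_list (tl p) 0}"

lemma num_walks_0: "num_walks Q 0 h k = (if h = 0 \<and> Q h \<and> k = 0 then 1 else 0)"
proof -
  have "{p \<in> walks Q 0 h. k \<le> count_list (tl p) 0} = (if h = 0 \<and> Q h \<and> k = 0 then {[h]} else {})"
    by auto
  then show ?thesis
    unfolding num_walks_def by (auto simp del: walks.simps)
qed

lemma card_visits_Cons:
  "card {q \<in> walks Q m h. k \<le> count_list q 0} = num_walks Q m h (if h = 0 then k - 1 else k)"
proof -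
  have "count_list q 0 = (if h = 0 then 1 else 0) + count_list (tl q) 0" if "q \<in> walks Q m h" for q
    using that by (cases q) (auto simp: mem_walks_iff)
  then show ?thesis
    unfolding num_walks_def by (intro arg_cong[where f = card]) auto
qed

lemma num_walks_Suc:
  "num_walks Q (Suc m) h k = (if Q h then num_walks Q m (h + 1) (if h = -1 then k - 1 else k)
     + num_walks Q m (h - 1) (if h = 1 then k - 1 else k) else 0)"
proof (cases "Q h")
  case False
  then show ?thesis by (simp add: num_walks_def)
next
  case True
  let ?A = "\<lambda>g. {q \<in> walks Q m g. k \<le> count_list q 0}"
  have "{p \<in> walks Q (Suc m) h. k \<le> count_list (tl p) 0} = Cons h ` (?A (h + 1) \<union> ?A (h - 1))"
    using True by auto
  then have "num_walks Q (Suc m) h k = card (?A (h + 1) \<union> ?A (h - 1))"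
    by (simp add: num_walks_def card_image)
  also have "\<dots> = card (?A (h + 1)) + card (?A (h - 1))"
  proof (rule card_Un_disjoint)
    show "?A (h + 1) \<inter> ?A (h - 1) = {}"
      by (auto simp: mem_walks_iff)
  qed (simp_all add: finite_walks)
  finally show ?thesis
    using True unfolding card_visits_Cons by (auto simp: algebra_simps)
qed

text \<open>Reflection in 0 exchanges the two branches of the recursion. It merges both first steps
  from 0 into a factor 2.\<close>

lemma num_walks_uminus: "num_walks (\<lambda>_. True) m (- h) k = num_walks (\<lambda>_. True) m h k"
proof (induction m arbitrary: h k)
  case 0
  then show ?case by (simp add: num_walks_0)
next
  case (Suc m)
  show ?case
    using Suc.IH[of "h + 1"] Suc.IH[of "h - 1"] by (simp add: num_walks_Suc)
qed

section \<open>Closed forms for the tail counts\<close>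

text \<open>Pascal's rule under truncated subtraction. For \<open>j > m\<close> all upper indices
  are 0, and the rule fails only at \<open>r = 0\<close>, where it would read
  \<open>0 + 1 = 0\<close>.\<close>

lemma pascal_diff:
  assumes "j \<le> m \<or> r > 0"
  shows "(m - j choose Suc r) + (m - j choose r) = (Suc m - j choose Suc r)"
  using assms by (cases "j \<le> m") (auto simp: Suc_diff_le binomial_eq_0)

text \<open>The guard \<open>k \<le> m\<close> is needed because of truncated subtraction: for \<open>m = 0\<close> and \<open>k > 0\<close> the
  binomial coefficient would be \<open>1\<close>. For \<open>g > 0\<close> the walk must hit \<open>0\<close> at its end, so \<open>k = 0\<close> and
  \<open>k = 1\<close> give the same count.\<close>

lemma num_walks_free:
  assumes "even (m + g)"
  shows "num_walks (\<lambda>_. True) m (int g) k =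
     (if g = 0 then if k \<le> m then 2 ^ k * (m - k choose (m div 2)) else 0
      else 2 ^ (k - 1) * (m - (k - 1) choose ((m + g) div 2)))"
  using assms
proof (induction m arbitrary: g k)
  case 0
  then show ?case
    by (cases "g = 0") (auto simp: num_walks_0 elim!: evenE intro!: binomial_eq_0)
next
  case (Suc m)
  \<comment> \<open>The recursion changes form near 0: from 0 both steps are symmetric, from 1 the
    down step uses up a visit, and from higher up no visit can occur in one step.\<close>
  consider "g = 0" | "g = 1" | f where "g = f + 2"
    by (metis One_nat_def add_2_eq_Suc' not0_implies_Suc)
  then show ?case
  proof cases
    case 1
    then obtain a where m: "m = 2 * a + 1"
      using Suc.prems by (auto elim!: oddE)
    have "num_walks (\<lambda>_. True) (Suc m) 0 k = 2 * num_walks (\<lambda>_. True) m (int 1) k"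
      using num_walks_uminus[of m 1 k] by (simp add: num_walks_Suc)
    also have "\<dots> = 2 * 2 ^ (k - 1) * (m - (k - 1) choose Suc a)"
      using m by (subst Suc.IH) auto
    also have "\<dots> = (if k \<le> Suc m then 2 ^ k * (Suc m - k choose (Suc m div 2)) else 0)"
    proof (cases k)
      case 0
      \<comment> \<open>For \<open>k = 0\<close> the power \<open>2 ^ k\<close> cannot absorb the
        factor 2; the doubling of the central binomial coefficient does.\<close>
      have "(2 * Suc a choose Suc a) = 2 * (2 * a + 1 choose Suc a)"
        using binomial_symmetric[of a "2 * a + 1"] by simp
      then show ?thesis using m 0 by simp
    next
      case (Suc j)
      then show ?thesis using m by (auto simp: binomial_eq_0)
    qed
    finally show ?thesis using 1 by simp
  next
    case 2
    then obtain a where m: "m = 2 * a"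
      using Suc.prems by (auto elim!: evenE)
    have "num_walks (\<lambda>_. True) (Suc m) 1 k =
        num_walks (\<lambda>_. True) m (int 2) k + num_walks (\<lambda>_. True) m (int 0) (k - 1)"
      by (simp add: num_walks_Suc)
    also have "num_walks (\<lambda>_. True) m (int 2) k = 2 ^ (k - 1) * (m - (k - 1) choose Suc a)"
      using m by (subst Suc.IH) auto
    also have "num_walks (\<lambda>_. True) m (int 0) (k - 1) =
        (if k - 1 \<le> m then 2 ^ (k - 1) * (m - (k - 1) choose a) else 0)"
      using m by (subst Suc.IH) auto
    \<comment> \<open>Here \<open>r = a\<close> may be 0, so Pascal's rule requires
      \<open>k - 1 \<le> m\<close>; otherwise all terms vanish.\<close>
    finally show ?thesis
      using 2 m pascal_diff[of "k - 1" m a]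
      by (cases "k - 1 \<le> m") (auto simp: binomial_eq_0 simp flip: distrib_left)
  next
    case 3
    then have "even (m + f + 1)"
      using Suc.prems by simp
    then obtain r where r: "m + f + 1 = 2 * r"
      by (elim evenE)
    have "num_walks (\<lambda>_. True) (Suc m) (int g) k =
        num_walks (\<lambda>_. True) m (int (f + 3)) k + num_walks (\<lambda>_. True) m (int (f + 1)) k"
      using 3 by (simp add: num_walks_Suc algebra_simps)
    also have "num_walks (\<lambda>_. True) m (int (f + 3)) k = 2 ^ (k - 1) * (m - (k - 1) choose Suc r)"
    proof -
      have "even (m + (f + 3))" "(m + (f + 3)) div 2 = Suc r" using r by presburger+
      then show ?thesis by (subst Suc.IH) auto
    qed
    also have "num_walks (\<lambda>_. True) m (int (f + 1)) k = 2 ^ (k - 1) * (m - (k - 1) choose r)"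
    proof -
      have "even (m + (f + 1))" "(m + (f + 1)) div 2 = r" using r by presburger+
      then show ?thesis by (subst Suc.IH) auto
    qed
    \<comment> \<open>The equation \<open>m + f + 1 = 2 * r\<close> forces \<open>r > 0\<close>, so
      Pascal's rule applies for every \<open>k\<close>.\<close>
    finally have "num_walks (\<lambda>_. True) (Suc m) (int g) k = 2 ^ (k - 1) * (Suc m - (k - 1) choose Suc r)"
      using pascal_diff[of "k - 1" m r] r by (simp flip: distrib_left)
    moreover have "(Suc m + g) div 2 = Suc r" using r 3 by presburger
    ultimately show ?thesis using 3 by simp
  qed
qed

lemma num_walks_neg:
  assumes "h < 0"
  shows "num_walks (\<lambda>i. i \<ge> 0) m h k = 0"
  using assms by (cases m) (simp_all add: num_walks_0 num_walks_Suc)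

text \<open>For \<open>k = 0\<close> this is the ballot formula. Both binomial coefficients of the
  difference obey Pascal's rule, so the induction runs as for free walks. From 0 only the up step
  survives, hence no power of 2. Working in \<open>int\<close> avoids truncated subtraction.\<close>

lemma num_walks_nonneg:
  assumes "even (m + g)"
  shows "int (num_walks (\<lambda>i. i \<ge> 0) m (int g) k) =
     (if g = 0 then if k \<le> m then int (m - k choose (m div 2)) - int (m - k choose Suc (m div 2)) else 0
      else int (m - (k - 1) choose ((m + g) div 2)) - int (m - (k - 1) choose Suc ((m + g) div 2)))"
  using assms
proof (induction m arbitrary: g k)
  case 0
  then show ?case
    by (cases "g = 0") (auto simp: num_walks_0 elim!: evenE intro!: binomial_eq_0)
next
  case (Suc m)
  let ?N = "num_walks (\<lambda>i. i \<ge> 0)"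
  consider "g = 0" | "g = 1" | f where "g = f + 2"
    by (metis One_nat_def add_2_eq_Suc' not0_implies_Suc)
  then show ?case
  proof cases
    case 1
    then obtain a where m: "m = 2 * a + 1"
      using Suc.prems by (auto elim!: oddE)
    have "?N (Suc m) 0 k = ?N m (int 1) k"
      by (simp add: num_walks_Suc num_walks_neg)
    also have "int \<dots> = int (m - (k - 1) choose Suc a) - int (m - (k - 1) choose Suc (Suc a))"
      using m by (subst Suc.IH) auto
    also have "\<dots> = (if k \<le> Suc m
        then int (Suc m - k choose (Suc m div 2)) - int (Suc m - k choose Suc (Suc m div 2)) else 0)"
    proof (cases k)
      case 0
      \<comment> \<open>After one expansion by Pascal's rule the two sides differ only by these two
        middle coefficients of an odd row.\<close>
      have "(2 * a + 1 choose a) = (2 * a + 1 choose Suc a)"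
        using binomial_symmetric[of a "2 * a + 1"] by simp
      then show ?thesis using m 0 by simp
    next
      case (Suc j)
      then show ?thesis using m by (auto simp: binomial_eq_0)
    qed
    finally show ?thesis using 1 by simp
  next
    case 2
    then obtain a where m: "m = 2 * a"
      using Suc.prems by (auto elim!: evenE)
    have "?N (Suc m) 1 k = ?N m (int 2) k + ?N m (int 0) (k - 1)"
      by (simp add: num_walks_Suc)
    moreover have "int (?N m (int 2) k) =
        int (m - (k - 1) choose Suc a) - int (m - (k - 1) choose Suc (Suc a))"
      using m by (subst Suc.IH) auto
    moreover have "int (?N m (int 0) (k - 1)) =
        (if k - 1 \<le> m then int (m - (k - 1) choose a) - int (m - (k - 1) choose Suc a) else 0)"
      using m by (subst Suc.IH) auto
    ultimately show ?thesis
      using 2 m pascal_diff[of "k - 1" m a] pascal_diff[of "k - 1" m "Suc a"]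
      by (cases "k - 1 \<le> m") (auto simp: binomial_eq_0)
  next
    case 3
    then have "even (m + f + 1)"
      using Suc.prems by simp
    then obtain r where r: "m + f + 1 = 2 * r"
      by (elim evenE)
    have "?N (Suc m) (int g) k = ?N m (int (f + 3)) k + ?N m (int (f + 1)) k"
      using 3 by (simp add: num_walks_Suc algebra_simps)
    moreover have "int (?N m (int (f + 3)) k) =
        int (m - (k - 1) choose Suc r) - int (m - (k - 1) choose Suc (Suc r))"
    proof -
      have "even (m + (f + 3))" "(m + (f + 3)) div 2 = Suc r" using r by presburger+
      then show ?thesis by (subst Suc.IH) auto
    qed
    moreover have "int (?N m (int (f + 1)) k) =
        int (m - (k - 1) choose r) - int (m - (k - 1) choose Suc r)"
    proof -
      have "even (m + (f + 1))" "(m + (f + 1)) div 2 = r" using r by presburger+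
      then show ?thesis by (subst Suc.IH) auto
    qed
    moreover have "(Suc m + g) div 2 = Suc r" using r 3 by presburger
    ultimately show ?thesis
      using 3 r pascal_diff[of "k - 1" m r] pascal_diff[of "k - 1" m "Suc r"] by simp
  qed
qed

section \<open>From counts to probabilities\<close>

text \<open>Heights have the parity of the time, so every zero occurs at an even time and none is
  missed by \<open>zero_times\<close>. The \<open>Suc\<close> accounts for time 0, which
  \<open>tl\<close> drops.\<close>

lemma card_zero_times:
  assumes "p \<in> srw_bridges n"
  shows "card (zero_times n p) = Suc (count_list (tl p) 0)"
proof -
  have len: "length p = 2 * n + 1" and zero: "p ! 0 = 0"
    and step: "\<And>k. k < 2 * n \<Longrightarrow> p ! (k + 1) - p ! k \<in> {1, -1}"
    using assms unfolding srw_bridges_def by auto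
  have parity: "even (p ! k) \<longleftrightarrow> even k" if "k \<le> 2 * n" for k
    using that
  proof (induction k)
    case 0
    then show ?case using zero by simp
  next
    case (Suc k)
    have "p ! Suc k - p ! k = 1 \<or> p ! Suc k - p ! k = -1"
      using step[of k] Suc.prems by simp
    then have "odd (p ! Suc k - p ! k)"
      by (metis odd_one even_minus)
    then show ?case using Suc by auto
  qed
  have "count_list (tl p) 0 = card {i. i < 2 * n \<and> p ! Suc i = 0}"
    using len by (auto simp: count_list_eq_length_filter length_filter_conv_card nth_tl intro!: arg_cong[where f = card])
  also have "\<dots> = card {t \<in> {1..n}. p ! (2 * t) = 0}"
  \<comment> \<open>Index \<open>i\<close> of \<open>tl p\<close> is time \<open>i + 1\<close>, so
    the zero at time \<open>2 * t\<close> sits at index \<open>2 * t - 1\<close>.\<close>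
  proof (rule bij_betw_same_card[symmetric], rule bij_betw_imageI)
    show "inj_on (\<lambda>t. 2 * t - 1) {t \<in> {1..n}. p ! (2 * t) = 0}"
      by (auto simp: inj_on_def)
    show "(\<lambda>t. 2 * t - 1) ` {t \<in> {1..n}. p ! (2 * t) = 0} = {i. i < 2 * n \<and> p ! Suc i = 0}"
    proof (intro set_eqI iffI)
      fix i assume "i \<in> (\<lambda>t. 2 * t - 1) ` {t \<in> {1..n}. p ! (2 * t) = 0}"
      then show "i \<in> {i. i < 2 * n \<and> p ! Suc i = 0}" by auto
    next
      fix i assume i: "i \<in> {i. i < 2 * n \<and> p ! Suc i = 0}"
      then have "even (Suc i)" using parity[of "Suc i"] by auto
      then obtain t where "Suc i = 2 * t" by (elim evenE)
      then show "i \<in> (\<lambda>t. 2 * t - 1) ` {t \<in> {1..n}. p ! (2 * t) = 0}"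
        using i by (intro image_eqI[of _ _ t]) auto
    qed
  qed
  finally show ?thesis
    by (simp add: zero_times_def)
qed

lemma srw_bridges_eq_walks: "srw_bridges n = walks (\<lambda>_. True) (2 * n) 0"
  by (auto simp: srw_bridges_def mem_walks_iff)

lemma dyck_paths_eq_walks: "dyck_paths n = walks (\<lambda>i. i \<ge> 0) (2 * n) 0"
proof (intro set_eqI)
  fix p :: "int list"
  have "(\<forall>k \<in> {1..2 * n - 1}. p ! k \<ge> 0) \<longleftrightarrow> (\<forall>k \<le> 2 * n. p ! k \<ge> 0)"
    if "p ! 0 = 0" "p ! (2 * n) = 0"
  proof -
    have "k = 0 \<or> k = 2 * n \<or> k \<in> {1..2 * n - 1}" if "k \<le> 2 * n" for k
      using that by auto
    moreover have "k \<le> 2 * n" if "k \<in> {1..2 * n - 1}" for k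
      using that by auto
    ultimately show ?thesis using that by (metis order_refl)
  qed
  then show "p \<in> dyck_paths n \<longleftrightarrow> p \<in> walks (\<lambda>i. i \<ge> 0) (2 * n) 0"
    by (auto simp: dyck_paths_def srw_bridges_def mem_walks_iff)
qed

text \<open>Under the uniform measure the probability is a ratio of counts; threshold 0 is vacuous
  and gives the total number of walks.\<close>

lemma prob_zero_times_ge:
  assumes "S = walks Q (2 * n) 0" "S \<subseteq> srw_bridges n" "S \<noteq> {}"
  shows "measure_pmf.prob (pmf_of_set S) {p. Suc k \<le> card (zero_times n p)} =
    num_walks Q (2 * n) 0 k / num_walks Q (2 * n) 0 0"
proof -
  have "S \<inter> {p. Suc k \<le> card (zero_times n p)} = {p \<in> walks Q (2 * n) 0. k \<le> count_list (tl p) 0}"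
    using assms card_zero_times by auto
  then show ?thesis
    using assms finite_walks by (subst measure_pmf_of_set) (auto simp: num_walks_def)
qed

lemma prob_SRWB:
  assumes "k \<le> n"
  shows "measure_pmf.prob (P_SRWB n) {p. Suc k \<le> card (zero_times n p)} =
    2 ^ k * (2 * n - k choose n) / (2 * n choose n)"
  unfolding P_SRWB_def
  using assms num_walks_free[of "2 * n" 0]
  by (subst prob_zero_times_ge[OF srw_bridges_eq_walks]) (auto simp: srw_bridges_nonempty)

text \<open>By absorption, \<open>n + 1\<close> times the second coefficient is \<open>n - k\<close>
  times the first, and \<open>(n + 1) - (n - k) = k + 1\<close>.\<close>

lemma ballot_difference:
  assumes "k \<le> n"
  shows "real (n + 1) * (real (2 * n - k choose n) - real (2 * n - k choose Suc n)) =
    real (k + 1) * (2 * n - k choose n)"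
proof -
  have "Suc n * (2 * n - k choose Suc n) = (n - k) * (2 * n - k choose n)"
  proof -
    have "2 * n - k - n = n - k" using assms by simp
    then show ?thesis
      using binomial_absorb_comp[of "2 * n - k" n] binomial_absorption[of n "2 * n - k"] by metis
  qed
  then have "real (n + 1) * real (2 * n - k choose Suc n) = (real n - real k) * real (2 * n - k choose n)"
    using assms by (metis Suc_eq_plus1 of_nat_diff of_nat_mult)
  then show ?thesis by (simp add: algebra_simps)
qed

lemma num_dyck:
  assumes "k \<le> n"
  shows "real (num_walks (\<lambda>i. i \<ge> 0) (2 * n) 0 k) = real (k + 1) * (2 * n - k choose n) / real (n + 1)"
proof -
  have "int (num_walks (\<lambda>i. i \<ge> 0) (2 * n) 0 k) = int (2 * n - k choose n) - int (2 * n - k choose Suc n)"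
    using num_walks_nonneg[of "2 * n" 0 k] assms by simp
  then have "real (num_walks (\<lambda>i. i \<ge> 0) (2 * n) 0 k) = real (2 * n - k choose n) - real (2 * n - k choose Suc n)"
    by linarith
  then show ?thesis
    using ballot_difference[OF assms] by (simp only: eq_divide_eq mult.commute) simp
qed

text \<open>The total count is the Catalan number, the case \<open>k = 0\<close> of
  \<open>num_dyck\<close>; the common factor \<open>1 / (n + 1)\<close> cancels.\<close>

lemma prob_Dyck:
  assumes "k \<le> n"
  shows "measure_pmf.prob (P_Dyck n) {p. Suc k \<le> card (zero_times n p)} =
    real (k + 1) * (2 * n - k choose n) / (2 * n choose n)"
  unfolding P_Dyck_def
  using num_dyck[OF assms] num_dyck[of 0 n] dyck_paths_nonempty
  by (subst prob_zero_times_ge[OF dyck_paths_eq_walks]) (simp_all add: dyck_paths_def)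

section \<open>Asymptotics of factorials and binomial coefficients\<close>

text \<open>In the induction step both bounds reduce to
  \<open>1 / (n + 1) \<le> ln (n + 1) - ln n \<le> 1 / n\<close>, which comes from
  \<open>ln t \<le> t - 1\<close> applied to the quotient and its inverse.\<close>

lemma ln_fact_bounds:
  assumes "n > 0"
  shows "real n * ln n - n \<le> ln (fact n)" "ln (fact n) \<le> real n * ln n - n + ln n + 1"
  using assms
proof (induction n rule: nat_induct_non_zero)
  case 1
  show "real 1 * ln (real 1) - real 1 \<le> ln (fact 1)" "ln (fact 1) \<le> real 1 * ln (real 1) - real 1 + ln (real 1) + 1"
    by simp_all
next
  case (Suc n)
  have fct: "ln (fact (Suc n)) = ln (real (Suc n)) + ln (fact n :: real)"
    using Suc.hyps by (subst fact_Suc, subst ln_mult) (auto simp del: of_nat_Suc)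
  have quotient: "ln (real (Suc n) / real n) = ln (real (Suc n)) - ln (real n)"
    using Suc.hyps by (subst ln_div) auto
  have "ln (real (Suc n) / real n) \<le> real (Suc n) / real n - 1"
    using Suc.hyps by (intro ln_le_minus_one) auto
  then have upper: "real n * (ln (real (Suc n)) - ln (real n)) \<le> 1"
    using Suc.hyps unfolding quotient by (simp add: field_simps)
  have "ln (real n / real (Suc n)) \<le> real n / real (Suc n) - 1"
    using Suc.hyps by (intro ln_le_minus_one) auto
  moreover have "ln (real n / real (Suc n)) = ln (real n) - ln (real (Suc n))"
    using Suc.hyps by (subst ln_div) auto
  moreover have "real n / real (Suc n) - 1 = - (1 / real (Suc n))"
    by (simp add: field_simps)
  ultimately have "1 / real (Suc n) \<le> ln (real (Suc n)) - ln (real n)"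
    by linarith
  then have lower: "real (Suc n) * (ln (real (Suc n)) - ln (real n)) \<ge> 1"
    by (subst (asm) pos_divide_le_eq) (simp_all add: mult.commute)
  show "real (Suc n) * ln (real (Suc n)) - real (Suc n) \<le> ln (fact (Suc n))"
    using Suc.IH upper unfolding fct by (simp add: algebra_simps)
  show "ln (fact (Suc n)) \<le> real (Suc n) * ln (real (Suc n)) - real (Suc n) + ln (real (Suc n)) + 1"
    using Suc.IH lower unfolding fct by (simp add: algebra_simps)
qed

text \<open>The linear terms of the three factorial estimates cancel. What remains is at most
  \<open>ln (n + j) + 1\<close> above and two such errors below.\<close>

lemma ln_binomial_bounds:
  assumes "n > 0" "j > 0"
  defines "e \<equiv> real (n + j) * ln (real (n + j)) - real n * ln (real n) - real j * ln (real j)"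
  shows "\<bar>ln (real (n + j choose n)) - e\<bar> \<le> 2 * ln (real (n + j)) + 2"
proof -
  have "real (n + j choose n) = fact (n + j) / (fact n * fact j)"
    using binomial_fact[of n "n + j", where 'a = real] by simp
  then have "ln (real (n + j choose n)) = ln (fact (n + j)) - (ln (fact n) + ln (fact j))"
    by (simp add: ln_div ln_mult)
  moreover have "ln (real n) \<le> ln (real (n + j))" "ln (real j) \<le> ln (real (n + j))"
    using assms by auto
  moreover have "ln (real n) \<ge> 0" "ln (real j) \<ge> 0"
    using assms by auto
  ultimately show ?thesis
    using ln_fact_bounds[OF assms(1)] ln_fact_bounds[OF assms(2)] ln_fact_bounds[of "n + j"] assms(1)
    unfolding e_def of_nat_add by linarith
qed

text \<open>Continuity up to the endpoint 0 realises the convention \<open>0 ln 0 = 0\<close> and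
  covers \<open>x = 1\<close> in the theorem.\<close>

lemma continuous_on_x_ln_x: "continuous_on {0..} (\<lambda>x::real. x * ln x)"
  unfolding continuous_on_def
proof
  fix a :: real assume "a \<in> {0..}"
  show "((\<lambda>x. x * ln x) \<longlongrightarrow> a * ln a) (at a within {0..})"
  proof (cases "a = 0")
    case True
    have "at (0::real) within {0..} = at_right 0"
      by (simp add: at_within_Ici_at_right)
    moreover have "((\<lambda>x::real. x * ln x) \<longlongrightarrow> 0) (at_right 0)"
      by real_asymp
    ultimately show ?thesis using True by simp
  next
    case False
    then show ?thesis by (intro tendsto_intros)
  qed
qed

text \<open>The main term of \<open>ln_binomial_bounds\<close> divided by \<open>n\<close> depends
  on \<open>j / n\<close> alone: its \<open>ln n\<close> contributions have coefficients
  \<open>n + j\<close>, \<open>n\<close> and \<open>j\<close>, which cancel. The error is of order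
  \<open>ln n / n\<close>.\<close>

lemma ln_binomial_asymptotics:
  fixes j :: "nat \<Rightarrow> nat"
  assumes j: "\<And>n. n > 0 \<Longrightarrow> 0 < j n \<and> j n \<le> n"
    and y: "(\<lambda>n. real (j n) / real n) \<longlonglongrightarrow> y"
  shows "(\<lambda>n. ln (real (n + j n choose n)) / real n) \<longlonglongrightarrow> (1 + y) * ln (1 + y) - y * ln y"
proof -
  let ?y = "\<lambda>n. real (j n) / real n"
  let ?H = "\<lambda>y::real. (1 + y) * ln (1 + y) - y * ln y"
  have "y \<ge> 0"
    by (rule LIMSEQ_le_const[OF y]) auto
  have xlnx: "(\<lambda>n. f n * ln (f n)) \<longlonglongrightarrow> c * ln c"
    if "f \<longlonglongrightarrow> c" "c \<ge> 0" "\<And>n. f n \<ge> 0" for f :: "nat \<Rightarrow> real" and c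
    using continuous_on_tendsto_compose[OF continuous_on_x_ln_x that(1)] that by simp
  have lim: "(\<lambda>n. ?H (?y n)) \<longlonglongrightarrow> ?H y"
    using \<open>y \<ge> 0\<close> by (intro tendsto_diff xlnx tendsto_add tendsto_const y) auto
  have "(\<lambda>n. ln (real (n + j n choose n)) / real n - ?H (?y n)) \<longlonglongrightarrow> 0"
  proof (rule tendsto_0_le)
    show "(\<lambda>n. (2 * ln (2 * real n) + 2) / real n) \<longlonglongrightarrow> 0"
      by real_asymp
    show "\<forall>\<^sub>F n in sequentially. norm (ln (real (n + j n choose n)) / real n - ?H (?y n))
        \<le> norm ((2 * ln (2 * real n) + 2) / real n) * 1"
      using eventually_gt_at_top[of 0]
    proof eventually_elim
      case (elim n)
      note jn = j[OF elim]
      have factor: "1 + ?y n = real (n + j n) / real n"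
        using elim by (simp add: field_simps)
      have "real n * ?H (?y n) = real (n + j n) * ln (real (n + j n)) - real n * ln (real n) - real (j n) * ln (real (j n))"
        unfolding factor using elim jn by (simp add: ln_div field_simps)
      moreover have "real n * \<bar>a / real n - b\<bar> = \<bar>a - real n * b\<bar>" for a b
      proof -
        have "a - real n * b = real n * (a / real n - b)"
          using elim by (simp add: right_diff_distrib)
        then show ?thesis by (simp add: abs_mult)
      qed
      ultimately have "real n * \<bar>ln (real (n + j n choose n)) / real n - ?H (?y n)\<bar> \<le> 2 * ln (real (n + j n)) + 2"
        using ln_binomial_bounds[of n "j n"] elim jn by presburger
      also have "\<dots> \<le> 2 * ln (2 * real n) + 2"
        using elim jn by auto
      finally show ?case
        using elim by (simp add: field_simps abs_of_nonneg)
    qed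
  qed
  from tendsto_add[OF this lim] show ?thesis by simp
qed

section \<open>The two limits\<close>

theorem theorem7:
  fixes x :: real
  assumes "x \<in> {0..1}"
  shows "((\<lambda>n. (1 / real n) * ln (measure_pmf.prob (P_SRWB n)
            {p. real (card (zero_times n p)) \<ge> real n * x})) \<longlonglongrightarrow> - I_SRWB x) \<and>
         ((\<lambda>n. (1 / real n) * ln (measure_pmf.prob (P_Dyck n)
            {p. real (card (zero_times n p)) \<ge> real n * x})) \<longlonglongrightarrow> - I_Dyck x)"
proof -
  \<comment> \<open>The event asks for \<open>nat \<lceil>real n * x\<rceil>\<close> zeros, one of
    which is time 0. If the ceiling is 0, truncation gives \<open>k n = 0\<close>, and the event is
    still certain.\<close>
  define k where "k n = nat \<lceil>real n * x\<rceil> - 1" for n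
  \<comment> \<open>Strictness keeps \<open>n - k n\<close> positive even at \<open>x = 1\<close>,
    as the binomial estimate demands.\<close>
  have k_less: "k n < n" if "n > 0" for n
  proof -
    have "real n * x \<le> real n" using assms by (simp add: mult_left_le)
    then show ?thesis using that unfolding k_def by linarith
  qed
  have event: "{p. real (card (zero_times n p)) \<ge> real n * x} = {p. Suc (k n) \<le> card (zero_times n p)}" for n
  proof -
    have "real (card (zero_times n p)) \<ge> real n * x \<longleftrightarrow> Suc (k n) \<le> card (zero_times n p)" for p
    proof -
      have nonempty: "card (zero_times n p) \<ge> 1"
        by (simp add: zero_times_def)
      have "real (card (zero_times n p)) \<ge> real n * x \<longleftrightarrow> nat \<lceil>real n * x\<rceil> \<le> card (zero_times n p)"
        by (simp add: nat_le_iff ceiling_le_iff)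
      also have "\<dots> \<longleftrightarrow> Suc (k n) \<le> card (zero_times n p)"
        unfolding k_def using nonempty by arith
      finally show ?thesis .
    qed
    then show ?thesis by simp
  qed
  have k_lim: "(\<lambda>n. real (k n) / real n) \<longlonglongrightarrow> x"
  proof (rule tendsto_sandwich)
    show "(\<lambda>n. x - 1 / real n) \<longlonglongrightarrow> x" "(\<lambda>n. x + 1 / real n) \<longlonglongrightarrow> x"
      by real_asymp+
    have bounds: "real n * x - 1 \<le> real (k n)" "real (k n) \<le> real n * x + 1" for n
    proof -
      have "real n * x \<ge> 0" using assms by simp
      then show "real n * x - 1 \<le> real (k n)" "real (k n) \<le> real n * x + 1"
        unfolding k_def by linarith+
    qed
    show "\<forall>\<^sub>F n in sequentially. x - 1 / real n \<le> real (k n) / real n"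
      using eventually_gt_at_top[of 0]
    proof eventually_elim
      case (elim n)
      have "(real n * x - 1) / real n \<le> real (k n) / real n"
        by (intro divide_right_mono bounds) simp
      then show ?case using elim by (simp add: diff_divide_distrib)
    qed
    show "\<forall>\<^sub>F n in sequentially. real (k n) / real n \<le> x + 1 / real n"
      using eventually_gt_at_top[of 0]
    proof eventually_elim
      case (elim n)
      have "real (k n) / real n \<le> (real n * x + 1) / real n"
        by (intro divide_right_mono bounds) simp
      then show ?case using elim by (simp add: add_divide_distrib)
    qed
  qed
  have "(\<lambda>n. 1 - real (k n) / real n) \<longlonglongrightarrow> 1 - x"
    by (intro tendsto_intros k_lim)
  moreover have "\<forall>\<^sub>F n in sequentially. 1 - real (k n) / real n = real (n - k n) / real n"
    using eventually_gt_at_top[of 0]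
    by eventually_elim (use k_less in \<open>simp add: field_simps of_nat_diff less_imp_le\<close>)
  ultimately have j_lim: "(\<lambda>n. real (n - k n) / real n) \<longlonglongrightarrow> 1 - x"
    by (rule Lim_transform_eventually)
  \<comment> \<open>The numerator has the form of \<open>n + j\<close> over \<open>n\<close> with
    \<open>j = n - k n\<close>, so the limit ratio is \<open>y = 1 - x\<close>.\<close>
  have "(\<lambda>n. ln (real (n + (n - k n) choose n)) / real n) \<longlonglongrightarrow> (2 - x) * ln (2 - x) - (1 - x) * ln (1 - x)"
    using ln_binomial_asymptotics[OF _ j_lim] k_less by simp
  moreover have "\<forall>\<^sub>F n in sequentially. ln (real (n + (n - k n) choose n)) / real n = ln (real (2 * n - k n choose n)) / real n"
    using eventually_gt_at_top[of 0]
    by eventually_elim (use k_less in \<open>simp add: less_imp_le mult_2\<close>)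
  ultimately have num: "(\<lambda>n. ln (real (2 * n - k n choose n)) / real n) \<longlonglongrightarrow> (2 - x) * ln (2 - x) - (1 - x) * ln (1 - x)"
    by (rule Lim_transform_eventually)
  \<comment> \<open>The denominator is the case \<open>j = n\<close>, with
    \<open>y = 1\<close>.\<close>
  have "(\<lambda>n. real n / real n) \<longlonglongrightarrow> 1"
    by real_asymp
  then have "(\<lambda>n. ln (real (n + n choose n)) / real n) \<longlonglongrightarrow> (1 + 1) * ln (1 + 1) - 1 * ln 1"
    by (rule ln_binomial_asymptotics[rotated]) simp
  then have den: "(\<lambda>n. ln (real (2 * n choose n)) / real n) \<longlonglongrightarrow> 2 * ln 2"
    by (simp flip: mult_2)
  have bin_pos: "real (2 * n - k n choose n) > 0" "real (2 * n choose n) > 0" if "n > 0" for n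
    using k_less[OF that] by auto
  \<comment> \<open>The factor \<open>2 ^ k\<close> contributes \<open>x * ln 2\<close> to the
    rate.\<close>
  have "(\<lambda>n. real (k n) / real n * ln 2 + ln (real (2 * n - k n choose n)) / real n - ln (real (2 * n choose n)) / real n)
      \<longlonglongrightarrow> x * ln 2 + ((2 - x) * ln (2 - x) - (1 - x) * ln (1 - x)) - 2 * ln 2"
    by (intro tendsto_intros k_lim num den)
  moreover have "\<forall>\<^sub>F n in sequentially.
      real (k n) / real n * ln 2 + ln (real (2 * n - k n choose n)) / real n - ln (real (2 * n choose n)) / real n =
      (1 / real n) * ln (measure_pmf.prob (P_SRWB n) {p. real (card (zero_times n p)) \<ge> real n * x})"
    using eventually_gt_at_top[of 0]
  proof eventually_elim
    case (elim n)
    then show ?case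
      unfolding event using bin_pos[OF elim] k_less[OF elim]
      by (subst prob_SRWB) (simp_all add: ln_div ln_mult ln_realpow field_simps)
  qed
  ultimately have srwb: "(\<lambda>n. (1 / real n) * ln (measure_pmf.prob (P_SRWB n)
            {p. real (card (zero_times n p)) \<ge> real n * x})) \<longlonglongrightarrow>
      x * ln 2 + ((2 - x) * ln (2 - x) - (1 - x) * ln (1 - x)) - 2 * ln 2"
    by (rule Lim_transform_eventually)
  \<comment> \<open>For Dyck paths \<open>k + 1\<close> replaces \<open>2 ^ k\<close>. Being at most
    \<open>n\<close>, it is invisible on the exponential scale, so the two rates differ exactly by
    \<open>x * ln 2\<close>.\<close>
  have poly_lim: "(\<lambda>n. ln (real (k n + 1)) / real n) \<longlonglongrightarrow> 0"
  proof (rule tendsto_sandwich[where f = "\<lambda>_. 0" and h = "\<lambda>n. ln (real n) / real n"])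
    show "(\<lambda>n. ln (real n) / real n) \<longlonglongrightarrow> 0"
      by real_asymp
    show "\<forall>\<^sub>F n in sequentially. ln (real (k n + 1)) / real n \<le> ln (real n) / real n"
      using eventually_gt_at_top[of 0]
    proof eventually_elim
      case (elim n)
      have "real (k n + 1) \<le> real n"
        using k_less[OF elim] by simp
      then have "ln (real (k n + 1)) \<le> ln (real n)"
        by (intro ln_mono) simp_all
      then show ?case
        by (rule divide_right_mono) simp
    qed
    show "\<forall>\<^sub>F n in sequentially. 0 \<le> ln (real (k n + 1)) / real n"
      by (intro always_eventually allI divide_nonneg_nonneg ln_ge_zero) simp_all
  qed (rule tendsto_const)
  have "(\<lambda>n. ln (real (k n + 1)) / real n + ln (real (2 * n - k n choose n)) / real n - ln (real (2 * n choose n)) / real n)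
      \<longlonglongrightarrow> 0 + ((2 - x) * ln (2 - x) - (1 - x) * ln (1 - x)) - 2 * ln 2"
    by (intro tendsto_intros poly_lim num den)
  moreover have "\<forall>\<^sub>F n in sequentially.
      ln (real (k n + 1)) / real n + ln (real (2 * n - k n choose n)) / real n - ln (real (2 * n choose n)) / real n =
      (1 / real n) * ln (measure_pmf.prob (P_Dyck n) {p. real (card (zero_times n p)) \<ge> real n * x})"
    using eventually_gt_at_top[of 0]
  proof eventually_elim
    case (elim n)
    then show ?case
      unfolding event using bin_pos[OF elim] k_less[OF elim]
      by (subst prob_Dyck) (simp_all add: ln_div ln_mult field_simps del: of_nat_add of_nat_Suc)
  qed
  ultimately have dyck: "(\<lambda>n. (1 / real n) * ln (measure_pmf.prob (P_Dyck n)
            {p. real (card (zero_times n p)) \<ge> real n * x})) \<longlonglongrightarrow>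
      0 + ((2 - x) * ln (2 - x) - (1 - x) * ln (1 - x)) - 2 * ln 2"
    by (rule Lim_transform_eventually)
  show ?thesis
    using srwb dyck by (simp add: I_SRWB_def I_Dyck_def algebra_simps)
qed

end
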